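(* Let $X$ be an almost automorphic subshift with maximal equicontinuous factor $(\Omega,\varrho)$, and assume that for every $\omega \in \Omega$ the set $\mathscr{O}(\omega) \cap B_X$ is finite (possibly empty). Then for any two orbits $\mathscr{O}(x_1)$ and $\mathscr{O}(x_2)$ in $X$, all of the following notions are equivalent: negatively proximal, positively proximal, two-sided proximal, negatively asymptotic, positively asymptotic, and two-sided asymptotic.
   Context: $\mathscr{A}$ is a finite alphabet; $\mathscr{A}^{\mathbb{Z}}$ carries the product topology and the left shift $\sigma(x)(j) = x(j+1)$. A subshift is a closed $\sigma$-invariant set $X \subseteq \mathscr{A}^{\mathbb{Z}}$; it is minimal if every orbit $\mathscr{O}(x) = \{\sigma^n(x) : n \in \mathbb{Z}\}$ is dense in $X$. Every minimal subshift $X$ has a maximal equicontinuous factor: a compact metrizable monothetic group $\Omega$ with the rotation $\varrho$ by a generator (an element generating a dense subgroup), and a factor map $\pi_X : X \to \Omega$ (continuous, surjective, $\pi_X \circ \sigma = \varrho \circ \pi_X$) such that every factor map from $X$ to a rotation by a generator on a compact metrizable monothetic group factors through $\pi_X$. A minimal subshift $X$ is almost automorphic if $\pi_X^{-1}(\omega)$ is a singleton for some (equivalently, for a dense set of) $\omega \in \Omega$. For $\omega \in \Omega$, $\mathscr{O}(\omega) = \{\varrho^n(\omega) : n \in \mathbb{Z}\}$. The separating cover generating $X$ consists of the sets $C_a = \pi_X(\{x \in X : x(0) = a\})$, $a \in \mathscr{A}$, and its boundary is $B_X = \bigcup_{a \neq b} (C_a \cap C_b)$. Let $d$ be a metric on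 $\mathscr{A}^{\mathbb{Z}}$ inducing its topology. Words $x_1,x_2$ are negatively proximal if $\liminf_{n \to -\infty} d(\sigma^n(x_1),\sigma^n(x_2)) = 0$ and negatively asymptotic if $\lim_{n \to -\infty} d(\sigma^n(x_1),\sigma^n(x_2)) = 0$. The positive and two-sided notions are obtained by replacing $n \to -\infty$ with $n \to \infty$ and $|n| \to \infty$, respectively. Two orbits $\mathscr{O}(x_1),\mathscr{O}(x_2)$ are said to have one of these properties if there is $n \in \mathbb{Z}$ such that the pair $x_1, \sigma^n(x_2)$ has it. *)

theory Defs
  imports "HOL-Analysis.Analysis" "HOL-Algebra.Group"
begin

section \<open>Subshifts over a finite alphabet\<close>

definition full_shift :: "'a set \<Rightarrow> (int \<Rightarrow> 'a) topology" where
  "full_shift A = product_topology (\<lambda>_. discrete_topology A) UNIV"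

text \<open>\<^term>\<open>shift n\<close> is the \<^term>\<open>n\<close>-th power of the left shift for every integer \<^term>\<open>n\<close>;
  the left shift itself is \<^term>\<open>shift 1\<close>.\<close>

definition shift :: "int \<Rightarrow> (int \<Rightarrow> 'a) \<Rightarrow> int \<Rightarrow> 'a" where
  "shift n x = (\<lambda>j. x (j + n))"

lemma shift_0: "shift 0 = id"
  by (auto simp: shift_def)

lemma shift_add: "shift (m + n) = shift m \<circ> shift n"
  by (auto simp: shift_def fun_eq_iff algebra_simps)

definition orbit :: "(int \<Rightarrow> 'a) \<Rightarrow> (int \<Rightarrow> 'a) set" where
  "orbit x = range (\<lambda>n. shift n x)"

definition subshift :: "'a set \<Rightarrow> (int \<Rightarrow> 'a) set \<Rightarrow> bool" where
  "subshift A X \<longleftrightarrow> closedin (full_shift A) X \<and> shift 1 ` X = X"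

definition minimal_subshift :: "'a set \<Rightarrow> (int \<Rightarrow> 'a) set \<Rightarrow> bool" where
  "minimal_subshift A X \<longleftrightarrow> subshift A X \<and>
     (\<forall>x\<in>X. subtopology (full_shift A) X closure_of orbit x = X)"


section \<open>Rotations on compact metrizable monothetic groups\<close>

definition topological_group :: "('g, 'm) monoid_scheme \<Rightarrow> 'g topology \<Rightarrow> bool" where
  "topological_group G T \<longleftrightarrow> group G \<and> topspace T = carrier G \<and>
     continuous_map (prod_topology T T) T (\<lambda>(x, y). x \<otimes>\<^bsub>G\<^esub> y) \<and>
     continuous_map T T (\<lambda>x. inv\<^bsub>G\<^esub> x)"

definition cm_monothetic :: "('g, 'm) monoid_scheme \<Rightarrow> 'g topology \<Rightarrow> 'g \<Rightarrow> bool" where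
  "cm_monothetic G T g \<longleftrightarrow> topological_group G T \<and> compact_space T \<and> metrizable_space T \<and>
     g \<in> carrier G \<and> T closure_of range (\<lambda>n::int. g [^]\<^bsub>G\<^esub> n) = carrier G"

text \<open>The \<^term>\<open>n\<close>-th power of the rotation by \<^term>\<open>g\<close> is the rotation by \<^term>\<open>g [^]\<^bsub>G\<^esub> n\<close>.
  The group is abelian, so left and right rotations agree.\<close>

definition rotation_orbit :: "('g, 'm) monoid_scheme \<Rightarrow> 'g \<Rightarrow> 'g \<Rightarrow> 'g set" where
  "rotation_orbit G g w = range (\<lambda>n::int. (g [^]\<^bsub>G\<^esub> n) \<otimes>\<^bsub>G\<^esub> w)"

definition rotation_factor_map ::
  "'a set \<Rightarrow> (int \<Rightarrow> 'a) set \<Rightarrow> ('g, 'm) monoid_scheme \<Rightarrow> 'g topology \<Rightarrow> 'g \<Rightarrow>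
   ((int \<Rightarrow> 'a) \<Rightarrow> 'g) \<Rightarrow> bool" where
  "rotation_factor_map A X G T g p \<longleftrightarrow>
     continuous_map (subtopology (full_shift A) X) T p \<and> p ` X = carrier G \<and>
     (\<forall>x\<in>X. p (shift 1 x) = g \<otimes>\<^bsub>G\<^esub> p x)"

text \<open>In the universal property the competing groups live on subsets of the type of
  words. This is no restriction, because a group onto which \<^term>\<open>X\<close> maps is
  isomorphic to one whose carrier is a subset of \<^term>\<open>X\<close>;
  see \<open>maximal_equicontinuous_factor_universal\<close> below.\<close>

definition maximal_equicontinuous_factor ::
  "'a set \<Rightarrow> (int \<Rightarrow> 'a) set \<Rightarrow> ('g, 'm) monoid_scheme \<Rightarrow> 'g topology \<Rightarrow> 'g \<Rightarrow>
   ((int \<Rightarrow> 'a) \<Rightarrow> 'g) \<Rightarrow> bool" where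
  "maximal_equicontinuous_factor A X G T g p \<longleftrightarrow>
     cm_monothetic G T g \<and> rotation_factor_map A X G T g p \<and>
     (\<forall>(H :: (int \<Rightarrow> 'a) monoid) S h q.
        cm_monothetic H S h \<and> rotation_factor_map A X H S h q \<longrightarrow>
        (\<exists>r. continuous_map T S r \<and> (\<forall>x\<in>X. q x = r (p x))))"

lemma maximal_equicontinuous_factor_universal:
  fixes H :: "('h, 'k) monoid_scheme" and X :: "(int \<Rightarrow> 'a) set"
  assumes mef: "maximal_equicontinuous_factor A X G T g p"
    and H: "cm_monothetic H S h" and q: "rotation_factor_map A X H S h q"
  shows "\<exists>r. continuous_map T S r \<and> (\<forall>x\<in>X. q x = r (p x))"
proof -
  interpret H: group H
    using H by (simp add: cm_monothetic_def topological_group_def)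
  have top: "topspace S = carrier H" "compact_space S" "metrizable_space S" "h \<in> carrier H"
    and mult: "continuous_map (prod_topology S S) S (\<lambda>(x, y). x \<otimes>\<^bsub>H\<^esub> y)"
    and inv: "continuous_map S S (\<lambda>x. inv\<^bsub>H\<^esub> x)"
    and dense: "S closure_of range (\<lambda>n::int. h [^]\<^bsub>H\<^esub> n) = carrier H"
    using H by (auto simp: cm_monothetic_def topological_group_def)
  have qX: "q ` X = carrier H" using q by (simp add: rotation_factor_map_def)
  define s where "s = inv_into X q"
  have qs: "q (s y) = y" if "y \<in> carrier H" for y
    using f_inv_into_f[of y q X] that by (simp add: s_def qX)
  define K where "K = s ` carrier H"
  have qK: "q u \<in> carrier H" "s (q u) = u" if "u \<in> K" for u
    using that qs by (auto simp: K_def)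
  have sK: "s y \<in> K" if "y \<in> carrier H" for y using that by (simp add: K_def)
  define H' :: "(int \<Rightarrow> 'a) monoid" where
    "H' = \<lparr>carrier = K, mult = (\<lambda>u v. s (q u \<otimes>\<^bsub>H\<^esub> q v)), one = s \<one>\<^bsub>H\<^esub>\<rparr>"
  define S' where "S' = pullback_topology K q S"
  have H'_simps: "carrier H' = K" "u \<otimes>\<^bsub>H'\<^esub> v = s (q u \<otimes>\<^bsub>H\<^esub> q v)" "\<one>\<^bsub>H'\<^esub> = s \<one>\<^bsub>H\<^esub>" for u v
    by (simp_all add: H'_def)
  have topS': "topspace S' = K"
    using qK top by (auto simp: S'_def topspace_pullback_topology)
  interpret H': group H'
  proof (rule groupI)
    fix x assume "x \<in> carrier H'"
    then show "\<exists>y\<in>carrier H'. y \<otimes>\<^bsub>H'\<^esub> x = \<one>\<^bsub>H'\<^esub>"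
      using qK sK qs by (intro bexI[of _ "s (inv\<^bsub>H\<^esub> q x)"]) (auto simp: H'_simps)
  qed (use qK sK qs in \<open>auto simp: H'_simps H.m_assoc\<close>)
  have hom_s: "s \<in> hom H H'"
    using qs sK by (auto simp: hom_def H'_simps)
  interpret s: group_hom H H' s
    using hom_s by (unfold_locales)
  have contq: "continuous_map S' S q"
    using continuous_map_pullback[of S S id K q] by (simp add: S'_def)
  have conts: "continuous_map S S' s"
    unfolding S'_def
  proof (rule continuous_map_pullback')
    show "continuous_map S S (q \<circ> s)"
      using qs top by (subst continuous_map_eq) (auto intro: continuous_map_eq[of S S id])
    show "topspace S \<subseteq> s -` K" using sK top by auto
  qed
  have hom: "homeomorphic_maps S S' s q"
    using conts contq qs qK top topS' by (auto simp: homeomorphic_maps_def)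
  then have hs: "homeomorphic_map S S' s" and hsp: "S homeomorphic_space S'"
    by (auto simp: homeomorphic_map_maps homeomorphic_space_def)
  have inv_eq: "inv\<^bsub>H'\<^esub> u = s (inv\<^bsub>H\<^esub> (q u))" if "u \<in> K" for u
    using s.hom_inv[of "q u"] qK that by simp
  have "continuous_map S' S' (s \<circ> (\<lambda>x. inv\<^bsub>H\<^esub> x) \<circ> q)"
    using conts contq inv by (intro continuous_map_compose)
  then have inv': "continuous_map S' S' (\<lambda>x. inv\<^bsub>H'\<^esub> x)"
    by (rule continuous_map_eq) (auto simp: inv_eq topS')
  have "continuous_map (prod_topology S' S') (prod_topology S S) (\<lambda>(u, v). (q u, q v))"
    using contq by (simp add: continuous_map_prod_top)
  then have "continuous_map (prod_topology S' S') S'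
      (s \<circ> (\<lambda>(x, y). x \<otimes>\<^bsub>H\<^esub> y) \<circ> (\<lambda>(u, v). (q u, q v)))"
    using conts mult by (intro continuous_map_compose)
  then have mult': "continuous_map (prod_topology S' S') S' (\<lambda>(x, y). x \<otimes>\<^bsub>H'\<^esub> y)"
    by (rule continuous_map_eq) (auto simp: H'_simps)
  have "S' closure_of (s ` range (\<lambda>n::int. h [^]\<^bsub>H\<^esub> n)) = s ` carrier H"
    using homeomorphic_map_closure_of[OF hs, of "range (\<lambda>n::int. h [^]\<^bsub>H\<^esub> n)"] dense top
    by (auto simp: image_subset_iff)
  moreover have "s ` range (\<lambda>n::int. h [^]\<^bsub>H\<^esub> n) = range (\<lambda>n::int. s h [^]\<^bsub>H'\<^esub> n)"
    using s.hom_int_pow[OF top(4)] by (auto simp: image_image)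
  ultimately have dense': "S' closure_of range (\<lambda>n::int. s h [^]\<^bsub>H'\<^esub> n) = carrier H'"
    by (simp add: H'_simps K_def)
  have "cm_monothetic H' S' (s h)"
    using H'.is_group mult' inv' dense' topS' sK top hsp
      homeomorphic_compact_space[OF hsp] homeomorphic_metrizable_space[OF hsp]
    by (simp add: cm_monothetic_def topological_group_def H'_simps)
  moreover have "rotation_factor_map A X H' S' (s h) (s \<circ> q)"
    unfolding rotation_factor_map_def
  proof (intro conjI ballI)
    show "continuous_map (subtopology (full_shift A) X) S' (s \<circ> q)"
      using q conts unfolding rotation_factor_map_def by (blast intro: continuous_map_compose)
    show "(s \<circ> q) ` X = carrier H'"
      using qX by (simp only: image_comp[symmetric] H'_simps K_def)
    fix x assume x: "x \<in> X"
    then have "q x \<in> carrier H" using qX by blast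
    then have "q (s h) = h" "q (s (q x)) = q x" using qs top by blast+
    moreover have "q (shift 1 x) = h \<otimes>\<^bsub>H\<^esub> q x"
      using q x by (simp add: rotation_factor_map_def)
    ultimately show "(s \<circ> q) (shift 1 x) = s h \<otimes>\<^bsub>H'\<^esub> (s \<circ> q) x"
      by (simp add: H'_simps)
  qed
  ultimately obtain r where r: "continuous_map T S' r" "\<forall>x\<in>X. (s \<circ> q) x = r (p x)"
    using mef unfolding maximal_equicontinuous_factor_def by blast
  have "continuous_map T S (q \<circ> r)"
    using r(1) contq by (rule continuous_map_compose)
  moreover have "\<forall>x\<in>X. q x = (q \<circ> r) (p x)"
    using r(2) qs qX by (metis comp_apply imageI)
  ultimately show ?thesis by blast
qed

text \<open>Here \<^term>\<open>p\<close> is meant to be the factor map onto the maximal equicontinuous factor, which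
  is unique up to isomorphism.\<close>

definition almost_automorphic ::
  "'a set \<Rightarrow> (int \<Rightarrow> 'a) set \<Rightarrow> ('g, 'm) monoid_scheme \<Rightarrow> ((int \<Rightarrow> 'a) \<Rightarrow> 'g) \<Rightarrow> bool" where
  "almost_automorphic A X G p \<longleftrightarrow>
     minimal_subshift A X \<and> (\<exists>w\<in>carrier G. is_singleton {x \<in> X. p x = w})"

definition separating_cover :: "(int \<Rightarrow> 'a) set \<Rightarrow> ((int \<Rightarrow> 'a) \<Rightarrow> 'g) \<Rightarrow> 'a \<Rightarrow> 'g set" where
  "separating_cover X p a = p ` {x \<in> X. x 0 = a}"

definition cover_boundary ::
  "'a set \<Rightarrow> (int \<Rightarrow> 'a) set \<Rightarrow> ((int \<Rightarrow> 'a) \<Rightarrow> 'g) \<Rightarrow> 'g set" where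
  "cover_boundary A X p =
     (\<Union>a\<in>A. \<Union>b\<in>A - {a}. separating_cover X p a \<inter> separating_cover X p b)"


section \<open>Proximality and asymptoticity\<close>

text \<open>The filter is \<^term>\<open>at_bot\<close> for the negative, \<^term>\<open>at_top\<close> for the positive, and
  \<open>abs_at_top\<close> for the two-sided notions.\<close>

definition abs_at_top :: "int filter" where
  "abs_at_top = filtercomap abs at_top"

definition proximal ::
  "int filter \<Rightarrow> ((int \<Rightarrow> 'a) \<Rightarrow> (int \<Rightarrow> 'a) \<Rightarrow> real) \<Rightarrow> (int \<Rightarrow> 'a) \<Rightarrow> (int \<Rightarrow> 'a) \<Rightarrow> bool" where
  "proximal F d x y \<longleftrightarrow> Liminf F (\<lambda>n. ereal (d (shift n x) (shift n y))) = 0"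

definition asymptotic ::
  "int filter \<Rightarrow> ((int \<Rightarrow> 'a) \<Rightarrow> (int \<Rightarrow> 'a) \<Rightarrow> real) \<Rightarrow> (int \<Rightarrow> 'a) \<Rightarrow> (int \<Rightarrow> 'a) \<Rightarrow> bool" where
  "asymptotic F d x y \<longleftrightarrow> ((\<lambda>n. d (shift n x) (shift n y)) \<longlongrightarrow> 0) F"

text \<open>A relation between words, lifted to a relation between their orbits.\<close>

definition orbits_rel ::
  "((int \<Rightarrow> 'a) \<Rightarrow> (int \<Rightarrow> 'a) \<Rightarrow> bool) \<Rightarrow> (int \<Rightarrow> 'a) \<Rightarrow> (int \<Rightarrow> 'a) \<Rightarrow> bool" where
  "orbits_rel R x y \<longleftrightarrow> (\<exists>n. R x (shift n y))"

end

theory Submission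
  imports Defs
begin

text \<open>
  If \<open>x\<close> and \<open>y\<close> are proximal in any direction, then \<open>p x = p y\<close>, because
  \<open>(p u)\<^sup>-\<^sup>1 (p v)\<close> is constant along the orbit of \<open>(x, y)\<close> and equals \<open>\<one>\<close> on the diagonal.
  If \<open>p x = p y = w\<close>, then every \<open>n\<close> with \<open>x n \<noteq> y n\<close> puts \<open>g\<^sup>n w\<close> into the boundary of
  the cover, so there are only finitely many such \<open>n\<close> when \<open>g\<close> has infinite order, and
  compactness makes \<open>x\<close> and \<open>y\<close> two-sided asymptotic. When \<open>g\<close> has finite order, the group is a
  single orbit, so that the one singleton fibre forces all fibres to be singletons.
\<close>

section \<open>Integer powers of the shift, and equivariance of the factor map\<close>

lemma topspace_full_shift [simp]: "topspace (full_shift A) = (UNIV \<rightarrow>\<^sub>E A)"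
  by (simp add: full_shift_def)

lemma compact_space_full_shift: "finite A \<Longrightarrow> compact_space (full_shift A)"
  by (simp add: full_shift_def compact_space_product_topology compact_space_discrete_topology)

lemma shift_shift [simp]: "shift m (shift n x) = shift (m + n) x"
  by (simp add: shift_add)

lemma subshift_subset: "subshift A X \<Longrightarrow> X \<subseteq> (UNIV \<rightarrow>\<^sub>E A)"
  using closedin_subset[of "full_shift A" X] by (simp add: subshift_def)

lemma subshift_closed_shift:
  assumes "subshift A X" "x \<in> X"
  shows "shift n x \<in> X"
proof -
  have X: "shift 1 ` X = X" using assms by (simp add: subshift_def)
  \<comment> \<open>The inverse shift preserves \<open>X\<close> because the image of
    \<open>X\<close> under \<open>shift 1\<close> is all of \<open>X\<close>, not merely contained
    in it.\<close>
  have unshift: "shift (- 1) u \<in> X" if "u \<in> X" for u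
  proof -
    have "u \<in> shift 1 ` X" using that by (simp only: X)
    then obtain v where "v \<in> X" "u = shift 1 v" by (rule imageE)
    then show ?thesis by (simp add: shift_0)
  qed
  show ?thesis
  proof (induction n rule: int_induct[where k = 0])
    case base
    show ?case using assms by (simp add: shift_0)
  next
    case (step1 i)
    then have "shift 1 (shift i x) \<in> shift 1 ` X" by (intro imageI)
    then have "shift 1 (shift i x) \<in> X" by (simp only: X)
    then show ?case by (simp add: add.commute)
  next
    case (step2 i)
    then have "shift (- 1) (shift i x) \<in> X" by (intro unshift)
    then show ?case by (simp add: add.commute)
  qed
qed

lemma rotation_factor_map_shift:
  assumes X: "subshift A X" and G: "group G" "g \<in> carrier G"
    and p: "rotation_factor_map A X G T g p" and x: "x \<in> X"
  shows "p (shift n x) = g [^]\<^bsub>G\<^esub> n \<otimes>\<^bsub>G\<^esub> p x"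
proof -
  interpret group G by fact
  have px: "p u \<in> carrier G" if "u \<in> X" for u
    using p that by (auto simp: rotation_factor_map_def)
  have step: "p (shift (1 + i) x) = g \<otimes>\<^bsub>G\<^esub> p (shift i x)" for i
    using p subshift_closed_shift[OF X x, of i]
    by (simp add: rotation_factor_map_def flip: shift_shift)
  show ?thesis
  proof (induction n rule: int_induct[where k = 0])
    case base
    show ?case using px[OF x] by (simp add: shift_0)
  next
    case (step1 i)
    then show ?case
      using step[of i] px[OF x] G int_pow_mult[of g 1 i] by (simp add: add.commute m_assoc)
  next
    case (step2 i)
    \<comment> \<open>Going downwards, the claim is first proved after multiplication by
      \<open>g\<close>; left cancellation then removes the factor.\<close>
    have "g \<otimes>\<^bsub>G\<^esub> p (shift (i - 1) x) = g \<otimes>\<^bsub>G\<^esub> (g [^]\<^bsub>G\<^esub> (i - 1) \<otimes>\<^bsub>G\<^esub> p x)"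
      using step[of "i - 1"] px[OF x] G int_pow_mult[of g 1 "i - 1"] step2
      by (simp add: m_assoc)
    then show ?case
      using px[OF x] px[OF subshift_closed_shift[OF X x]] G by simp
  qed
qed

section \<open>Closeness in the metric and agreement on finite windows\<close>

locale full_shift_metric = Metric_space M d
  for M :: "(int \<Rightarrow> 'a) set" and d +
  fixes A :: "'a set"
  assumes mtopology_eq: "mtopology = full_shift A" and finite_alphabet: "finite A"
begin

lemma M_eq: "M = (UNIV \<rightarrow>\<^sub>E A)"
  using mtopology_eq topspace_full_shift by (metis topspace_mtopology)

end

text \<open>Each point has a cylinder inside its ball of radius \<open>\<epsilon> / 2\<close>. By
  compactness finitely many such cylinders cover the space, and the union of their windows serves
  all points at once. No formula for \<open>d\<close> enters, only its topology.\<close>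

lemma (in full_shift_metric) cylinders_uniformly_small:
  assumes \<epsilon>: "\<epsilon> > 0"
  obtains F where "finite F"
    "\<And>u v. \<lbrakk>u \<in> M; v \<in> M; \<And>j. j \<in> F \<Longrightarrow> u j = v j\<rbrakk> \<Longrightarrow> d u v < \<epsilon>"
proof -
  have "\<exists>F. finite F \<and> (\<forall>u\<in>M. (\<forall>j\<in>F. u j = z j) \<longrightarrow> u \<in> mball z (\<epsilon> / 2))" if z: "z \<in> M" for z
  proof -
    have "openin (full_shift A) (mball z (\<epsilon> / 2))" and z': "z \<in> mball z (\<epsilon> / 2)"
      using z \<epsilon> by (auto simp flip: mtopology_eq)
    then have "\<forall>u\<in>mball z (\<epsilon> / 2). \<exists>U. finite {i. U i \<noteq> A} \<and>
        u \<in> Pi\<^sub>E UNIV U \<and> Pi\<^sub>E UNIV U \<subseteq> mball z (\<epsilon> / 2)"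
      unfolding full_shift_def openin_product_topology_alt
      by (intro ballI) (drule (1) bspec, simp, meson)
    then obtain U where U: "finite {i. U i \<noteq> A}" "z \<in> Pi\<^sub>E UNIV U"
        "Pi\<^sub>E UNIV U \<subseteq> mball z (\<epsilon> / 2)"
      using z' by blast
    \<comment> \<open>A basic open box restricts only the finitely many coordinates with
      \<open>U i \<noteq> A\<close>. There \<open>u\<close> agrees with \<open>z\<close>; elsewhere
      \<open>u \<in> M\<close> suffices.\<close>
    have "u \<in> Pi\<^sub>E UNIV U" if "u \<in> M" "\<forall>j\<in>{i. U i \<noteq> A}. u j = z j" for u
    proof (rule PiE_I)
      show "u j \<in> U j" for j
        using that U(2) M_eq by (cases "U j = A") (auto simp: PiE_iff)
    qed auto
    then show ?thesis
      using U(1,3) by (intro exI[of _ "{i. U i \<noteq> A}"] conjI ballI impI subsetD[OF U(3)])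
  qed
  then obtain F where F: "\<And>z. z \<in> M \<Longrightarrow> finite (F z)"
      "\<And>z u. \<lbrakk>z \<in> M; u \<in> M; \<forall>j\<in>F z. u j = z j\<rbrakk> \<Longrightarrow> u \<in> mball z (\<epsilon> / 2)"
    by metis
  define C where "C z = {u \<in> M. \<forall>j\<in>F z. u j = z j}" for z
  have "openin (full_shift A) (C z)" if z: "z \<in> M" for z
  proof -
    have "C z = (\<Pi>\<^sub>E j\<in>UNIV. if j \<in> F z then {z j} else A)"
    proof (intro equalityI subsetI)
      fix u assume "u \<in> (\<Pi>\<^sub>E j\<in>UNIV. if j \<in> F z then {z j} else A)"
      then have u: "u j \<in> (if j \<in> F z then {z j} else A)" for j by (simp add: PiE_iff)
      have "u j \<in> A" for j using u[of j] z by (auto simp: M_eq PiE_iff split: if_splits)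
      moreover have "u j = z j" if "j \<in> F z" for j using u[of j] that by simp
      ultimately show "u \<in> C z" by (simp add: C_def M_eq PiE_iff)
    qed (auto simp: C_def M_eq PiE_iff)
    moreover have "finite {j. (if j \<in> F z then {z j} else A) \<noteq> A}"
      by (rule finite_subset[OF _ F(1)[OF z]]) auto
    ultimately show ?thesis
      using z M_eq by (auto simp: full_shift_def openin_PiE_gen PiE_iff)
  qed
  moreover have "M \<subseteq> \<Union> (C ` M)" by (auto simp: C_def)
  moreover have "compactin (full_shift A) M"
    using compact_space_full_shift[OF finite_alphabet] by (simp add: compact_space_def M_eq)
  ultimately obtain \<Z> where \<Z>: "finite \<Z>" "\<Z> \<subseteq> C ` M" "M \<subseteq> \<Union> \<Z>"
    using compactinD[of "full_shift A" M "C ` M"] by blast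
  then obtain Z where Z: "Z \<subseteq> M" "finite Z" "\<Z> = C ` Z" by (meson finite_subset_image)
  show thesis
  proof
    show "finite (\<Union> (F ` Z))" using Z(1,2) F(1) by (auto simp only: finite_UN)
    fix u v assume uv: "u \<in> M" "v \<in> M" "\<And>j. j \<in> \<Union> (F ` Z) \<Longrightarrow> u j = v j"
    obtain z where z: "z \<in> Z" "u \<in> C z" using \<Z>(3) uv(1) unfolding Z(3) by blast
    have zM: "z \<in> M" using z(1) Z(1) by (rule subsetD[rotated])
    have uz: "\<forall>j\<in>F z. u j = z j" using z(2) unfolding C_def by blast
    \<comment> \<open>The window of \<open>z\<close> is part of the union, so \<open>v\<close> lies
      in the same cylinder as \<open>u\<close>, and both are within \<open>\<epsilon> / 2\<close> of
      \<open>z\<close>.\<close>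
    have "v j = z j" if "j \<in> F z" for j
    proof -
      have "u j = v j" by (rule uv(3)) (use z(1) that in blast)
      then show ?thesis using uz that by metis
    qed
    then have "\<forall>j\<in>F z. v j = z j" by (intro ballI)
    then have "d z v < \<epsilon> / 2" using F(2)[OF zM uv(2)] unfolding in_mball by blast
    moreover have "d z u < \<epsilon> / 2" using F(2)[OF zM uv(1) uz] unfolding in_mball by blast
    ultimately show "d u v < \<epsilon>"
      using triangle[OF uv(1) zM uv(2)] commute[of z u] by linarith
  qed
qed

section \<open>The three directions at infinity, asymptoticity and proximality\<close>

lemma eventually_abs_at_top:
  "eventually P abs_at_top \<longleftrightarrow> (\<exists>N. \<forall>n. N \<le> \<bar>n\<bar> \<longrightarrow> P n)"
  by (auto simp: abs_at_top_def eventually_filtercomap eventually_at_top_linorder)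

lemma abs_at_top_neq_bot: "abs_at_top \<noteq> bot"
  unfolding trivial_limit_def eventually_abs_at_top by (metis abs_ge_self)

lemma at_bot_le_abs_at_top: "at_bot \<le> abs_at_top"
proof (rule filter_leI)
  fix P assume "eventually P abs_at_top"
  then obtain N where "\<forall>n. N \<le> \<bar>n\<bar> \<longrightarrow> P n" by (auto simp: eventually_abs_at_top)
  then have "\<forall>n \<le> - N. P n" by auto
  then show "eventually P at_bot" by (auto simp: eventually_at_bot_linorder)
qed

lemma at_top_le_abs_at_top: "at_top \<le> abs_at_top"
proof (rule filter_leI)
  fix P assume "eventually P abs_at_top"
  then obtain N where "\<forall>n. N \<le> \<bar>n\<bar> \<longrightarrow> P n" by (auto simp: eventually_abs_at_top)
  then have "\<forall>n \<ge> N. P n" by auto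
  then show "eventually P at_top" by (auto simp: eventually_at_top_linorder)
qed

text \<open>Once \<open>\<bar>n\<bar>\<close> is large, the finite difference set has been moved out
  of any given finite window.\<close>

lemma (in full_shift_metric) finite_differences_imp_asymptotic:
  assumes xy: "x \<in> M" "y \<in> M" and fin: "finite {n. x n \<noteq> y n}"
  shows "asymptotic abs_at_top d x y"
  unfolding asymptotic_def
proof (rule tendstoI)
  fix e :: real assume "e > 0"
  then obtain F where F: "finite F"
      "\<And>u v. \<lbrakk>u \<in> M; v \<in> M; \<And>j. j \<in> F \<Longrightarrow> u j = v j\<rbrakk> \<Longrightarrow> d u v < e"
    using cylinders_uniformly_small by metis
  have shM: "shift n u \<in> M" if "u \<in> M" for n u
    using that by (auto simp: M_eq shift_def PiE_iff)
  \<comment> \<open>A difference at \<open>m\<close> is seen at the window coordinate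
    \<open>j\<close> after shifting by \<open>n\<close> exactly when \<open>j + n = m\<close>, so
    \<open>D\<close> contains all bad values of \<open>n\<close>.\<close>
  define D where "D = (\<lambda>(m, j). m - j) ` ({n. x n \<noteq> y n} \<times> F)"
  have "finite D" using fin F by (simp add: D_def)
  then obtain N where N: "\<And>k. k \<in> abs ` D \<Longrightarrow> k < N"
    by (meson bdd_above_finite bdd_above.unfold finite_imageI gt_ex le_less_trans)
  have "dist (d (shift n x) (shift n y)) 0 < e" if n: "N \<le> \<bar>n\<bar>" for n
  proof -
    have "n \<notin> D" using N n by force
    then have "x (j + n) = y (j + n)" if "j \<in> F" for j
      using that by (force simp: D_def image_iff)
    then show ?thesis using F(2)[of "shift n x" "shift n y"] shM xy by (simp add: shift_def)
  qed
  then show "\<forall>\<^sub>F n in abs_at_top. dist (d (shift n x) (shift n y)) 0 < e"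
    by (auto simp: eventually_abs_at_top)
qed

text \<open>If all distances were at least \<open>e\<close>, so would be the lower limit. The filter
  is arbitrary, so from here on the direction of proximality is irrelevant.\<close>

lemma proximal_imp_close:
  assumes "proximal F d x y" "e > 0"
  shows "\<exists>n. d (shift n x) (shift n y) < e"
proof (rule ccontr)
  assume "\<not> ?thesis"
  then have "ereal e \<le> Liminf F (\<lambda>n. ereal (d (shift n x) (shift n y)))"
    by (intro Liminf_bounded) (auto simp: not_less)
  then show False using assms by (simp add: proximal_def)
qed

lemma asymptotic_imp_proximal:
  assumes "F \<noteq> bot" "asymptotic F d x y"
  shows "proximal F d x y"
  using assms unfolding asymptotic_def proximal_def zero_ereal_def
  by (intro lim_imp_Liminf) auto

lemma asymptotic_mono: "\<lbrakk>F \<le> F'; asymptotic F' d x y\<rbrakk> \<Longrightarrow> asymptotic F d x y"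
  unfolding asymptotic_def by (rule tendsto_mono)

section \<open>Proximal words lie in the same fibre\<close>

text \<open>If the constant value \<open>c\<close> of the difference cocycle \<open>f\<close> along
  the orbit pair is not the identity, then \<open>f\<close> avoids \<open>c\<close> near every
  diagonal point. A Lebesgue number makes this uniform on the compact set \<open>X\<close>,
  contradicting arbitrarily close pairs.\<close>

lemma (in full_shift_metric) close_orbits_imp_same_fibre:
  assumes X: "subshift A X" and G: "cm_monothetic G T g"
    and p: "rotation_factor_map A X G T g p"
    and xy: "x \<in> X" "y \<in> X"
    and close: "\<And>e. e > 0 \<Longrightarrow> \<exists>n. d (shift n x) (shift n y) < e"
  shows "p x = p y"
proof (rule ccontr)
  assume neq: "p x \<noteq> p y"
  have grp: "group G" and g: "g \<in> carrier G" and cT: "topspace T = carrier G"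
    and mult: "continuous_map (prod_topology T T) T (\<lambda>(x, y). x \<otimes>\<^bsub>G\<^esub> y)"
    and inv: "continuous_map T T (\<lambda>x. inv\<^bsub>G\<^esub> x)" and met: "metrizable_space T"
    using G by (auto simp: cm_monothetic_def topological_group_def)
  interpret G: group G by fact
  have pc: "p u \<in> carrier G" if "u \<in> X" for u
    using p that by (auto simp: rotation_factor_map_def)
  have XM: "X \<subseteq> M" and clX: "closedin mtopology X"
    using X subshift_subset[OF X] unfolding mtopology_eq by (simp_all add: subshift_def M_eq)
  let ?S = "subtopology mtopology X"
  have topS: "topspace ?S = X" using XM by auto
  have contp: "continuous_map ?S T p" using p mtopology_eq by (simp add: rotation_factor_map_def)
  define f where "f = (\<lambda>(u, v). inv\<^bsub>G\<^esub> (p u) \<otimes>\<^bsub>G\<^esub> p v)"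
  define c where "c = f (x, y)"
  \<comment> \<open>The two powers of \<open>g\<close> meet in the middle of the product, as an
    inverse next to the element itself, and cancel without commutativity.\<close>
  have f_shift: "f (shift n x, shift n y) = c" for n
    using rotation_factor_map_shift[OF X grp g p xy(1)] rotation_factor_map_shift[OF X grp g p xy(2)]
      pc xy g
    by (simp add: f_def c_def G.inv_mult_group G.m_assoc) (simp add: G.m_assoc[symmetric])
  have c: "c \<in> carrier G" "c \<noteq> \<one>\<^bsub>G\<^esub>"
    using neq pc xy by (auto simp: c_def f_def G.inv_solve_left')
  have contf: "continuous_map (prod_topology ?S ?S) T f"
  proof -
    have "continuous_map (prod_topology ?S ?S) (prod_topology T T) (\<lambda>(u, v). (inv\<^bsub>G\<^esub> (p u), p v))"
      using contp continuous_map_compose[OF contp inv]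
      by (simp add: continuous_map_prod_top o_def)
    from continuous_map_compose[OF this mult] show ?thesis
      by (rule continuous_map_eq) (auto simp: f_def)
  qed
  have "openin T (carrier G - {c})"
    using met c by (metis metrizable_imp_t1_space cT openin_diff openin_topspace t1_space_closedin_singleton)
  define W where "W = {uv \<in> topspace (prod_topology ?S ?S). f uv \<in> carrier G - {c}}"
  have op: "openin (prod_topology ?S ?S) W"
    unfolding W_def by (rule openin_continuous_map_preimage) fact+
  have "\<exists>N. openin mtopology N \<and> z \<in> N \<and> (\<forall>u\<in>N \<inter> X. \<forall>v\<in>N \<inter> X. f (u, v) \<noteq> c)" if z: "z \<in> X" for z
  proof -
    have "f (z, z) = \<one>\<^bsub>G\<^esub>" using pc z by (simp add: f_def)
    then have "(z, z) \<in> W" using c z topS by (auto simp: W_def)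
    then obtain U V where UV: "openin ?S U" "openin ?S V" "z \<in> U" "z \<in> V" "U \<times> V \<subseteq> W"
      using op unfolding openin_prod_topology_alt by metis
    \<comment> \<open>Intersecting the two sides of the box puts both arguments of \<open>f\<close>
      into one neighbourhood of \<open>z\<close>; \<open>N\<close> is its extension to an open set
      of the full shift, as the Lebesgue number lemma requires.\<close>
    then have "openin ?S (U \<inter> V)" by (intro openin_Int)
    then obtain N where N: "openin mtopology N" "U \<inter> V = N \<inter> X"
      by (auto simp: openin_subtopology)
    have "f (u, v) \<noteq> c" if "u \<in> N \<inter> X" "v \<in> N \<inter> X" for u v
    proof -
      have "(u, v) \<in> W" using that UV(5) unfolding N(2)[symmetric] by blast
      then show ?thesis by (simp add: W_def)
    qed
    moreover have "z \<in> N" using UV(3,4) N(2) by blast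
    ultimately show ?thesis using N(1) by blast
  qed
  then obtain N where N: "\<And>z. z \<in> X \<Longrightarrow> openin mtopology (N z)" "\<And>z. z \<in> X \<Longrightarrow> z \<in> N z"
      "\<And>z u v. \<lbrakk>z \<in> X; u \<in> N z \<inter> X; v \<in> N z \<inter> X\<rbrakk> \<Longrightarrow> f (u, v) \<noteq> c"
    by metis
  have "compactin mtopology X"
    using closedin_compact_space[OF _ clX] compact_space_full_shift[OF finite_alphabet] mtopology_eq by simp
  moreover have "X \<subseteq> \<Union> (N ` X)" using N by auto
  moreover have "\<And>U. U \<in> N ` X \<Longrightarrow> openin mtopology U" using N by auto
  ultimately obtain e where e: "e > 0" "\<forall>u\<in>X. \<exists>U\<in>N ` X. mball u e \<subseteq> U"
    by (meson lebesgue_number)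
  obtain n where n: "d (shift n x) (shift n y) < e" using close e by blast
  have shX: "shift n x \<in> X" "shift n y \<in> X" using subshift_closed_shift[OF X] xy by auto
  then obtain z where z: "z \<in> X" "mball (shift n x) e \<subseteq> N z" using e by blast
  \<comment> \<open>Both words lie in the ball of radius \<open>e\<close> around
    \<open>shift n x\<close>, hence in a single \<open>N z\<close>.\<close>
  then have "shift n x \<in> N z" "shift n y \<in> N z" using n shX XM e by (auto simp: subset_iff)
  then show False using N(3)[of z] z shX f_shift by blast
qed

section \<open>Words in one fibre differ at finitely many coordinates\<close>

text \<open>A finite orbit of the identity is closed, hence the whole group.\<close>

lemma cm_monothetic_finite_order:
  assumes G: "cm_monothetic G T g" and ninj: "\<not> inj (\<lambda>n::int. g [^]\<^bsub>G\<^esub> n)"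
  shows "carrier G = range (\<lambda>n::int. g [^]\<^bsub>G\<^esub> n)"
proof -
  have g: "g \<in> carrier G" and cT: "topspace T = carrier G" and met: "metrizable_space T"
    and dense: "T closure_of range (\<lambda>n::int. g [^]\<^bsub>G\<^esub> n) = carrier G"
    using G by (auto simp: cm_monothetic_def topological_group_def)
  interpret group G using G by (simp add: cm_monothetic_def topological_group_def)
  obtain i j :: int where "i < j" "g [^]\<^bsub>G\<^esub> i = g [^]\<^bsub>G\<^esub> j"
    using ninj by (metis injI linorder_neqE)
  then have k: "j - i > 0" "g [^]\<^bsub>G\<^esub> (j - i) = \<one>\<^bsub>G\<^esub>"
    using g by (simp_all add: int_pow_diff)
  \<comment> \<open>A positive period of \<open>g\<close>: every power depends only on its exponent
    modulo \<open>k\<close>, so there are finitely many powers.\<close>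
  define k where "k = j - i"
  have "g [^]\<^bsub>G\<^esub> n = g [^]\<^bsub>G\<^esub> (n mod k)" for n
  proof -
    have "g [^]\<^bsub>G\<^esub> (k * (n div k)) = \<one>\<^bsub>G\<^esub>"
      using g k by (simp add: k_def flip: int_pow_pow)
    then show ?thesis
      using g int_pow_mult[of g "k * (n div k)" "n mod k"] by simp
  qed
  moreover have "n mod k \<in> {0..<k}" for n using k by (simp add: k_def)
  ultimately have "range (\<lambda>n::int. g [^]\<^bsub>G\<^esub> n) \<subseteq> (\<lambda>n::int. g [^]\<^bsub>G\<^esub> n) ` {0..<k}"
    by blast
  then have "finite (range (\<lambda>n::int. g [^]\<^bsub>G\<^esub> n))" by (rule finite_subset) simp
  then have "closedin T (range (\<lambda>n::int. g [^]\<^bsub>G\<^esub> n))"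
    using metrizable_imp_t1_space[OF met] g cT by (auto simp: t1_space_closedin_finite)
  then show ?thesis using dense closure_of_closedin by metis
qed

text \<open>The assumption \<open>fin\<close> counts points of the rotation orbit, while the
  conclusion counts times \<open>n\<close>. The two counts match only if the powers of
  \<open>g\<close> are distinct; the periodic case is settled by the singleton fibre.\<close>

lemma same_fibre_imp_finite_differences:
  assumes G: "cm_monothetic G T g" and p: "rotation_factor_map A X G T g p"
    and aa: "almost_automorphic A X G p"
    and fin: "\<And>w. w \<in> carrier G \<Longrightarrow> finite (rotation_orbit G g w \<inter> cover_boundary A X p)"
    and xy: "x \<in> X" "y \<in> X" and eq: "p x = p y"
  shows "finite {n. x n \<noteq> y n}"
proof -
  have X: "subshift A X" using aa by (simp add: almost_automorphic_def minimal_subshift_def)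
  have grp: "group G" and g: "g \<in> carrier G"
    using G by (auto simp: cm_monothetic_def topological_group_def)
  interpret group G by fact
  have pc: "p u \<in> carrier G" if "u \<in> X" for u
    using p that by (auto simp: rotation_factor_map_def)
  note psh = rotation_factor_map_shift[OF X grp g p]
  have XA: "u n \<in> A" if "u \<in> X" for u n
    using subshift_subset[OF X] that by (auto simp: PiE_iff)
  show ?thesis
  proof (cases "inj (\<lambda>n::int. g [^]\<^bsub>G\<^esub> n)")
    case True
    define h where "h n = g [^]\<^bsub>G\<^esub> n \<otimes>\<^bsub>G\<^esub> p x" for n :: int
    have "inj h" using True g pc xy by (auto simp: h_def inj_def)
    have "h n \<in> rotation_orbit G g (p x) \<inter> cover_boundary A X p" if "x n \<noteq> y n" for n
    proof -
      have "h n = p (shift n x)" "h n = p (shift n y)"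
        using psh xy eq by (auto simp: h_def)
      \<comment> \<open>The symbol of \<open>shift n u\<close> at \<open>0\<close> is
        \<open>u n\<close>, so a difference at time \<open>n\<close> puts \<open>h n\<close> into
        two distinct cover sets.\<close>
      moreover have "p (shift n u) \<in> separating_cover X p (u n)" if "u \<in> X" for u
        using subshift_closed_shift[OF X that, of n]
        unfolding separating_cover_def by (intro imageI) (simp add: shift_def)
      ultimately have "h n \<in> separating_cover X p (x n)" "h n \<in> separating_cover X p (y n)"
        using xy by metis+
      then show ?thesis
        using that XA xy by (auto simp: cover_boundary_def rotation_orbit_def h_def)
    qed
    then have "{n. x n \<noteq> y n} \<subseteq> h -` (rotation_orbit G g (p x) \<inter> cover_boundary A X p)"
      by auto
    then show ?thesis
      using fin[OF pc[OF xy(1)]] \<open>inj h\<close> by (meson finite_subset finite_vimageI)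
  next
    case False
    obtain w u where w: "w \<in> carrier G" "{x \<in> X. p x = w} = {u}"
      using aa by (auto simp: almost_automorphic_def is_singleton_def)
    \<comment> \<open>The group consists of powers of \<open>g\<close>, so some rotation carries
      \<open>p x\<close> to the point \<open>w\<close> with singleton fibre.\<close>
    have "w \<otimes>\<^bsub>G\<^esub> inv\<^bsub>G\<^esub> (p x) \<in> carrier G" using w pc xy by simp
    then obtain n :: int where n: "g [^]\<^bsub>G\<^esub> n = w \<otimes>\<^bsub>G\<^esub> inv\<^bsub>G\<^esub> (p x)"
      using cm_monothetic_finite_order[OF G False] by (metis imageE)
    then have "g [^]\<^bsub>G\<^esub> n \<otimes>\<^bsub>G\<^esub> p x = w"
      using w(1) pc[OF xy(1)] by (simp add: m_assoc)
    then have "p (shift n x) = w" "p (shift n y) = w"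
      using psh[OF xy(1), of n] psh[OF xy(2), of n] eq by simp_all
    then have "shift n x \<in> {u}" "shift n y \<in> {u}"
      using subshift_closed_shift[OF X] xy unfolding w(2)[symmetric] by simp_all
    \<comment> \<open>Shifting back gives \<open>x = y\<close>, so the difference set is
      empty.\<close>
    then have "shift (- n) (shift n x) = shift (- n) (shift n y)" by simp
    then show ?thesis by (simp add: shift_0)
  qed
qed

theorem proposition4p1:
  fixes A :: "'a set" and X :: "(int \<Rightarrow> 'a) set"
    and G :: "('g, 'm) monoid_scheme" and T :: "'g topology" and g :: 'g
    and p :: "(int \<Rightarrow> 'a) \<Rightarrow> 'g"
    and d :: "(int \<Rightarrow> 'a) \<Rightarrow> (int \<Rightarrow> 'a) \<Rightarrow> real"
    and x1 x2 :: "int \<Rightarrow> 'a"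
  assumes "finite A"
    and "Metric_space (topspace (full_shift A)) d"
    and "Metric_space.mtopology (topspace (full_shift A)) d = full_shift A"
    and "maximal_equicontinuous_factor A X G T g p"
    and "almost_automorphic A X G p"
    and "\<And>w. w \<in> carrier G \<Longrightarrow> finite (rotation_orbit G g w \<inter> cover_boundary A X p)"
    and "x1 \<in> X" and "x2 \<in> X"
  shows "(orbits_rel (proximal at_bot d) x1 x2 \<longleftrightarrow> orbits_rel (proximal at_top d) x1 x2) \<and>
    (orbits_rel (proximal at_bot d) x1 x2 \<longleftrightarrow> orbits_rel (proximal abs_at_top d) x1 x2) \<and>
    (orbits_rel (proximal at_bot d) x1 x2 \<longleftrightarrow> orbits_rel (asymptotic at_bot d) x1 x2) \<and>
    (orbits_rel (proximal at_bot d) x1 x2 \<longleftrightarrow> orbits_rel (asymptotic at_top d) x1 x2) \<and>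
    (orbits_rel (proximal at_bot d) x1 x2 \<longleftrightarrow> orbits_rel (asymptotic abs_at_top d) x1 x2)"
proof -
  interpret M: full_shift_metric "topspace (full_shift A)" d A
    using assms(1-3) by (simp add: full_shift_metric_def full_shift_metric_axioms_def)
  have G: "cm_monothetic G T g" and p: "rotation_factor_map A X G T g p"
    using assms(4) by (auto simp: maximal_equicontinuous_factor_def)
  have X: "subshift A X"
    using assms(5) by (simp add: almost_automorphic_def minimal_subshift_def)
  \<comment> \<open>Proximality along any filter \<open>F\<close> yields the strongest of the six
    notions, with the same shift \<open>m\<close>.\<close>
  have asym: "asymptotic abs_at_top d x1 (shift m x2)"
    if "proximal F d x1 (shift m x2)" for F m
  proof -
    have x2: "shift m x2 \<in> X" using subshift_closed_shift[OF X] assms by blast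
    have "p x1 = p (shift m x2)"
      using M.close_orbits_imp_same_fibre[OF X G p assms(7) x2]
        proximal_imp_close[OF that] by blast
    then have "finite {n. x1 n \<noteq> shift m x2 n}"
      using same_fibre_imp_finite_differences[OF G p assms(5,6,7) x2] by blast
    moreover have "X \<subseteq> topspace (full_shift A)" using subshift_subset[OF X] by simp
    ultimately show ?thesis
      using M.finite_differences_imp_asymptotic x2 assms(7) by blast
  qed
  \<comment> \<open>Two-sided asymptoticity passes to the finer filters \<open>at_bot\<close> and
    \<open>at_top\<close>, and asymptoticity along a nontrivial filter gives proximality;
    \<open>asym\<close> closes the circle. The equivalences hold for each \<open>m\<close>
    separately, hence also for orbits.\<close>
  have "proximal at_bot d x1 (shift m x2) = proximal at_top d x1 (shift m x2)"
    "proximal at_bot d x1 (shift m x2) = proximal abs_at_top d x1 (shift m x2)"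
    "proximal at_bot d x1 (shift m x2) = asymptotic at_bot d x1 (shift m x2)"
    "proximal at_bot d x1 (shift m x2) = asymptotic at_top d x1 (shift m x2)"
    "proximal at_bot d x1 (shift m x2) = asymptotic abs_at_top d x1 (shift m x2)" for m
    using asym asymptotic_imp_proximal asymptotic_mono at_bot_le_abs_at_top at_top_le_abs_at_top
      abs_at_top_neq_bot trivial_limit_at_bot_linorder trivial_limit_at_top_linorder
    by metis+
  then show ?thesis by (simp add: orbits_rel_def)
qed

end
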